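(* Let $a=1+a_2\mathbf{j}+a_3\mathbf{k}\in\mathbb{H}_s$ with $a_2,a_3\in\mathbb{R}$ and $I_a=0$ (i.e. $a_2^2+a_3^2=1$), and let $c\in\mathbb{H}_s$. Then the equation $ax^2+c=0$ has a solution $x\in\mathbb{H}_s$ if and only if $ac=2c$. Moreover, if it is solvable, then its solutions are given by $$x\in\sqrt[s]{-\tfrac{c}{2}+\tfrac{\bar a}{2}\,y},$$ where $y$ ranges over those elements of $\mathbb{H}_s$ for which $\sqrt[s]{-\tfrac{c}{2}+\tfrac{\bar a}{2}y}\neq\emptyset$; that is, the solution set is $\bigcup_{y\in\mathbb{H}_s}\sqrt[s]{-\tfrac{c}{2}+\tfrac{\bar a}{2}y}$.
   Context: $\mathbb{H}_s$ is the real algebra of split quaternions $x=x_0+x_1\mathbf{i}+x_2\mathbf{j}+x_3\mathbf{k}$ ($x_i\in\mathbb{R}$), with $\mathbf{i}^2=-1$, $\mathbf{j}^2=\mathbf{k}^2=1$, $\mathbf{i}\mathbf{j}=\mathbf{k}=-\mathbf{j}\mathbf{i}$, $\mathbf{j}\mathbf{k}=-\mathbf{i}=-\mathbf{k}\mathbf{j}$, $\mathbf{k}\mathbf{i}=\mathbf{j}=-\mathbf{i}\mathbf{k}$. The conjugate is $\bar x=x_0-x_1\mathbf{i}-x_2\mathbf{j}-x_3\mathbf{k}$, and $I_x=\bar x x=x\bar x=x_0^2+x_1^2-x_2^2-x_3^2$. For $w\in\mathbb{H}_s$, $\sqrt[s]{w}=\{x\in\mathbb{H}_s: x^2=w\}$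 denotes the (possibly empty) set of square roots of $w$ in $\mathbb{H}_s$. *)

theory Defs
  imports Complex_Main
begin

datatype split_quat =
  SQuat (sq0: real) (sq1: real) (sq2: real) (sq3: real)

lemma split_quat_eq_iff:
  "x = y \<longleftrightarrow> sq0 x = sq0 y \<and> sq1 x = sq1 y \<and> sq2 x = sq2 y \<and> sq3 x = sq3 y"
  by (cases x; cases y) simp

instantiation split_quat :: real_algebra_1
begin

definition zero_split_quat :: split_quat where "0 = SQuat 0 0 0 0"

definition one_split_quat :: split_quat where "1 = SQuat 1 0 0 0"

definition plus_split_quat :: "split_quat \<Rightarrow> split_quat \<Rightarrow> split_quat" where
  "x + y = SQuat (sq0 x + sq0 y) (sq1 x + sq1 y) (sq2 x + sq2 y) (sq3 x + sq3 y)"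

definition minus_split_quat :: "split_quat \<Rightarrow> split_quat \<Rightarrow> split_quat" where
  "x - y = SQuat (sq0 x - sq0 y) (sq1 x - sq1 y) (sq2 x - sq2 y) (sq3 x - sq3 y)"

definition uminus_split_quat :: "split_quat \<Rightarrow> split_quat" where
  "- x = SQuat (- sq0 x) (- sq1 x) (- sq2 x) (- sq3 x)"

definition scaleR_split_quat :: "real \<Rightarrow> split_quat \<Rightarrow> split_quat" where
  "r *\<^sub>R x = SQuat (r * sq0 x) (r * sq1 x) (r * sq2 x) (r * sq3 x)"

text \<open>The bilinear extension of the multiplication table of the units, which is checked below
  in \<open>split_quat_mult_table\<close>.\<close>

definition times_split_quat :: "split_quat \<Rightarrow> split_quat \<Rightarrow> split_quat" where
  "x * y = SQuat
     (sq0 x * sq0 y - sq1 x * sq1 y + sq2 x * sq2 y + sq3 x * sq3 y)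
     (sq0 x * sq1 y + sq1 x * sq0 y - sq2 x * sq3 y + sq3 x * sq2 y)
     (sq0 x * sq2 y + sq2 x * sq0 y + sq3 x * sq1 y - sq1 x * sq3 y)
     (sq0 x * sq3 y + sq3 x * sq0 y + sq1 x * sq2 y - sq2 x * sq1 y)"

lemmas split_quat_ops =
  zero_split_quat_def one_split_quat_def plus_split_quat_def minus_split_quat_def
  uminus_split_quat_def scaleR_split_quat_def times_split_quat_def

instance
  by standard (simp_all add: split_quat_ops split_quat_eq_iff algebra_simps)

end

definition sq_i :: split_quat where "sq_i = SQuat 0 1 0 0"
definition sq_j :: split_quat where "sq_j = SQuat 0 0 1 0"
definition sq_k :: split_quat where "sq_k = SQuat 0 0 0 1"

lemma split_quat_mult_table:
  "sq_i * sq_i = - 1" "sq_j * sq_j = 1" "sq_k * sq_k = 1"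
  "sq_i * sq_j = sq_k" "sq_j * sq_i = - sq_k"
  "sq_j * sq_k = - sq_i" "sq_k * sq_j = sq_i"
  "sq_k * sq_i = sq_j" "sq_i * sq_k = - sq_j"
  by (simp_all add: split_quat_ops sq_i_def sq_j_def sq_k_def)

lemma split_quat_expand:
  "x = of_real (sq0 x) + sq1 x *\<^sub>R sq_i + sq2 x *\<^sub>R sq_j + sq3 x *\<^sub>R sq_k"
  by (simp add: of_real_def split_quat_ops sq_i_def sq_j_def sq_k_def)

definition sq_cnj :: "split_quat \<Rightarrow> split_quat" where
  "sq_cnj x = SQuat (sq0 x) (- sq1 x) (- sq2 x) (- sq3 x)"

text \<open>The quadratic form \<open>I\<^sub>x\<close>; \<open>sq_I_eq\<close> identifies it with both products of \<open>x\<close> and its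
  conjugate, reals being embedded by \<open>of_real\<close>.\<close>

definition sq_I :: "split_quat \<Rightarrow> real" where
  "sq_I x = (sq0 x)\<^sup>2 + (sq1 x)\<^sup>2 - (sq2 x)\<^sup>2 - (sq3 x)\<^sup>2"

lemma sq_I_eq:
  "sq_cnj x * x = of_real (sq_I x)" "x * sq_cnj x = of_real (sq_I x)"
  by (simp_all add: of_real_def split_quat_ops sq_cnj_def sq_I_def power2_eq_square)

definition sq_sqrt :: "split_quat \<Rightarrow> split_quat set" where
  "sq_sqrt w = {x. x\<^sup>2 = w}"

end

theory Submission imports Defs begin

text \<open>
  Let \<open>b\<close> be the conjugate of \<open>a\<close>. Since \<open>a\<close> has real part \<open>1\<close> and norm \<open>0\<close>, it satisfies
  \<open>a + b = 2\<close>, \<open>a b = 0\<close> and hence \<open>a\<^sup>2 = 2 a\<close>: the halves of \<open>a\<close> and \<open>b\<close> are complementary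
  idempotents. Multiplying \<open>c = - a x\<^sup>2\<close> by \<open>a\<close> shows that \<open>a c = 2 c\<close> is necessary. Once it
  holds, \<open>a w = - c\<close> is a linear equation in \<open>w\<close> with particular solution \<open>- c / 2\<close> and with
  homogeneous solutions \<open>b y / 2\<close>, so the solutions \<open>x\<close> are the square roots of the elements
  \<open>- c / 2 + b y / 2\<close>.

  Solvability is not automatic from this, because a split quaternion need not have a square
  root. The point is that the right ideal \<open>a \<H>\<^sub>s\<close> is spanned by \<open>a\<close> and \<open>a i\<close>, so every element
  of it can be written as \<open>a z\<close> with \<open>z\<close> in the copy of the complex numbers spanned by \<open>1\<close> and
  \<open>i\<close>, and there square roots always exist.
\<close>

definition sq_of_complex :: "complex \<Rightarrow> split_quat" where
  "sq_of_complex z = SQuat (Re z) (Im z) 0 0"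

lemma sq_of_complex_mult: "sq_of_complex (z * w) = sq_of_complex z * sq_of_complex w"
  by (simp add: sq_of_complex_def split_quat_ops)

lemma sq_of_complex_csqrt: "(sq_of_complex (csqrt z))\<^sup>2 = sq_of_complex z"
  by (metis power2_csqrt power2_eq_square sq_of_complex_mult)

lemma add_sq_cnj: "x + sq_cnj x = of_real (2 * sq0 x)"
  by (simp add: split_quat_eq_iff split_quat_ops of_real_def sq_cnj_def)

text \<open>The quadratic equation \<open>a\<^sup>2 - 2 (Re a) a + I\<^sub>a = 0\<close> of a split quaternion, in the case of
  norm zero and real part \<open>1\<close>.\<close>

lemma square_eq_double:
  assumes "sq0 a = 1" and "sq_I a = 0"
  shows "a * a = 2 * a"
proof -
  have "a * a = a * (a + sq_cnj a)"
    using assms(2) by (simp add: distrib_left sq_I_eq)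
  also have "\<dots> = 2 * a"
    using assms(1) by (simp add: add_sq_cnj mult_2 mult_2_right)
  finally show ?thesis .
qed

text \<open>In the complex coordinates \<open>a = 1 + \<alpha> j\<close> and \<open>d = u + v j\<close>, where \<open>j\<close> moves past a
  complex number by conjugating it, the \<open>j\<close> part of \<open>a d = 2 d\<close> reads \<open>v = \<alpha> cnj u\<close>. This is
  exactly the \<open>j\<close> part of \<open>a u\<close>, so \<open>d\<close> is recovered from its complex part \<open>u\<close>.\<close>

lemma fixed_eq_mult_complex:
  assumes a: "a = 1 + a2 *\<^sub>R sq_j + a3 *\<^sub>R sq_k"
    and d: "a * d = 2 * d"
  shows "d = a * sq_of_complex (Complex (sq0 d) (sq1 d))"
proof -
  have "a * d = d + d"
    using d by (simp add: mult_2)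
  then show ?thesis
    by (simp add: a split_quat_eq_iff split_quat_ops sq_j_def sq_k_def sq_of_complex_def)
qed

theorem theorem2p1:
  fixes a c :: split_quat and a2 a3 :: real
  assumes "a = 1 + a2 *\<^sub>R sq_j + a3 *\<^sub>R sq_k"
    and "sq_I a = 0"
  shows "((\<exists>x. a * x\<^sup>2 + c = 0) \<longleftrightarrow> a * c = 2 * c) \<and>
    ((\<exists>x. a * x\<^sup>2 + c = 0) \<longrightarrow>
      {x. a * x\<^sup>2 + c = 0} =
        (\<Union>y\<in>{y. sq_sqrt (- ((1/2) *\<^sub>R c) + ((1/2) *\<^sub>R sq_cnj a) * y) \<noteq> {}}.
           sq_sqrt (- ((1/2) *\<^sub>R c) + ((1/2) *\<^sub>R sq_cnj a) * y)) \<and>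
      {x. a * x\<^sup>2 + c = 0} =
        (\<Union>y. sq_sqrt (- ((1/2) *\<^sub>R c) + ((1/2) *\<^sub>R sq_cnj a) * y)))"
proof -
  define w where "w y = - ((1/2) *\<^sub>R c) + ((1/2) *\<^sub>R sq_cnj a) * y" for y
  have re: "sq0 a = 1"
    by (simp add: assms(1) split_quat_ops sq_j_def sq_k_def)
  have aa: "a * a = 2 * a"
    by (rule square_eq_double[OF re assms(2)])
  have double: "2 * c = 2 *\<^sub>R c"
    by (simp add: mult_2 scaleR_2)

  have necessary: "a * c = 2 * c" if "a * x\<^sup>2 + c = 0" for x
  proof -
    from that have c: "c = - (a * x\<^sup>2)"
      by (metis minus_unique)
    have "a * c = - (a * a * x\<^sup>2)"
      by (simp add: c mult.assoc)
    also have "\<dots> = 2 * c"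
      by (simp add: aa c mult.assoc)
    finally show ?thesis .
  qed

  have sufficient: "\<exists>x. a * x\<^sup>2 + c = 0" if ac: "a * c = 2 * c"
  proof -
    have "a * (- c) = 2 * (- c)"
      using ac by simp
    from fixed_eq_mult_complex[OF assms(1) this]
    obtain z where "- c = a * sq_of_complex z"
      by blast
    then have "a * (sq_of_complex (csqrt z))\<^sup>2 + c = 0"
      by (metis sq_of_complex_csqrt add.left_inverse)
    then show ?thesis
      by blast
  qed

  have solutions: "{x. a * x\<^sup>2 + c = 0} = (\<Union>y. sq_sqrt (w y))" if ac: "a * c = 2 * c"
  proof (intro set_eqI iffI)
    fix x
    assume "x \<in> {x. a * x\<^sup>2 + c = 0}"
    then have c: "- c = a * x\<^sup>2"
      by (simp add: eq_neg_iff_add_eq_0 neg_eq_iff_add_eq_0 add.commute)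
    \<comment> \<open>The parameter \<open>y = x\<^sup>2\<close> works because \<open>a\<close> and its conjugate add up to \<open>2\<close>.\<close>
    have "w (x\<^sup>2) = (1/2) *\<^sub>R (- c + sq_cnj a * x\<^sup>2)"
      by (simp add: w_def scaleR_add_right scaleR_diff_right)
    also have "\<dots> = (1/2) *\<^sub>R ((a + sq_cnj a) * x\<^sup>2)"
      by (simp only: c distrib_right)
    also have "\<dots> = x\<^sup>2"
      by (simp add: add_sq_cnj re mult_2 flip: scaleR_2)
    finally have "x \<in> sq_sqrt (w (x\<^sup>2))"
      by (simp add: sq_sqrt_def)
    then show "x \<in> (\<Union>y. sq_sqrt (w y))"
      by blast
  next
    fix x
    assume "x \<in> (\<Union>y. sq_sqrt (w y))"
    then obtain y where "x\<^sup>2 = w y"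
      by (auto simp: sq_sqrt_def)
    then have "a * x\<^sup>2 = - ((1/2) *\<^sub>R (a * c)) + (1/2) *\<^sub>R (a * sq_cnj a * y)"
      by (simp add: w_def distrib_left right_diff_distrib mult.assoc)
    also have "\<dots> = - c"
      by (simp add: ac double sq_I_eq assms(2))
    finally show "x \<in> {x. a * x\<^sup>2 + c = 0}"
      by simp
  qed

  have "(\<Union>y\<in>{y. sq_sqrt (w y) \<noteq> {}}. sq_sqrt (w y)) = (\<Union>y. sq_sqrt (w y))"
    by blast
  with necessary sufficient solutions show ?thesis
    unfolding w_def by metis
qed

end
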